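(* Let $X$ be a compact Hausdorff space and let $\Gamma$ be a discrete group acting on $X$ by homeomorphisms. Let $\mathcal D=C(X)$ and $\mathcal C=C(X)\rtimes_r\Gamma$. Then the relative commutant $\mathcal D^c$ of $\mathcal D$ in $\mathcal C$ is abelian if and only if $H^x$ is an abelian group for every $x\in X$.
   Context: For $s\in\Gamma$ and $f\in C(X)$ let $\alpha_s(f)(x)=f(s^{-1}x)$; $C(X)\rtimes_r\Gamma$ is the reduced crossed product for this action, in which $\mathcal D=C(X)$ is identified with its canonical image. $\mathcal D^c=\{a\in\mathcal C: ad=da\text{ for all }d\in\mathcal D\}$. For $s\in\Gamma$, $F_s=\{x\in X:sx=x\}$ and $F_s^\circ$ is its interior. For $x\in X$, the germ isotropy group at $x$ is $H^x=\{s\in\Gamma:x\in F_s^\circ\}$ (a subgroup of $\Gamma$). *)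

theory Defs
  imports "HOL-Analysis.Analysis" "HOL-Algebra.Group_Action"
begin

section \<open>The Hilbert space of square-summable functions on an index type\<close>

typedef 'i ell2 = "{\<xi> :: 'i \<Rightarrow> complex. (\<lambda>i. (cmod (\<xi> i))\<^sup>2) summable_on UNIV}"
  by (rule exI[of _ "\<lambda>_. 0"]) simp

setup_lifting type_definition_ell2

lemma ell2_summable: "(\<lambda>i. (cmod (Rep_ell2 \<xi> i))\<^sup>2) summable_on UNIV"
  using Rep_ell2[of \<xi>] by simp

lemma square_summable_add:
  fixes f g :: "'i \<Rightarrow> complex"
  assumes "(\<lambda>i. (cmod (f i))\<^sup>2) summable_on UNIV" "(\<lambda>i. (cmod (g i))\<^sup>2) summable_on UNIV"
  shows "(\<lambda>i. (cmod (f i + g i))\<^sup>2) summable_on UNIV"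
proof (rule summable_on_comparison_test)
  show "(\<lambda>i. 2 * (cmod (f i))\<^sup>2 + 2 * (cmod (g i))\<^sup>2) summable_on UNIV"
    using assms by (intro summable_on_add summable_on_cmult_right)
  show "(cmod (f i + g i))\<^sup>2 \<le> 2 * (cmod (f i))\<^sup>2 + 2 * (cmod (g i))\<^sup>2" for i
  proof -
    have "(cmod (f i + g i))\<^sup>2 \<le> (cmod (f i) + cmod (g i))\<^sup>2"
      by (intro power_mono norm_triangle_ineq) auto
    also have "\<dots> \<le> 2 * (cmod (f i))\<^sup>2 + 2 * (cmod (g i))\<^sup>2"
      using sum_squares_bound[of "cmod (f i)" "cmod (g i)"] by (simp add: power2_sum)
    finally show ?thesis .
  qed
qed auto

lemma square_summable_inner:
  fixes f g :: "'i \<Rightarrow> complex"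
  assumes "(\<lambda>i. (cmod (f i))\<^sup>2) summable_on UNIV" "(\<lambda>i. (cmod (g i))\<^sup>2) summable_on UNIV"
  shows "(\<lambda>i. inner (f i) (g i)) summable_on UNIV"
proof (rule abs_summable_summable, rule summable_on_comparison_test)
  show "(\<lambda>i. (cmod (f i))\<^sup>2 + (cmod (g i))\<^sup>2) summable_on UNIV"
    using assms by (intro summable_on_add)
  show "norm (inner (f i) (g i)) \<le> (cmod (f i))\<^sup>2 + (cmod (g i))\<^sup>2" for i
  proof -
    have "norm (inner (f i) (g i)) \<le> cmod (f i) * cmod (g i)"
      by (simp add: Cauchy_Schwarz_ineq2)
    also have "\<dots> \<le> (cmod (f i))\<^sup>2 + (cmod (g i))\<^sup>2"
      using sum_squares_bound[of "cmod (f i)" "cmod (g i)"]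
        mult_nonneg_nonneg[OF norm_ge_zero[of "f i"] norm_ge_zero[of "g i"]] by linarith
    finally show ?thesis .
  qed
qed auto

lemma square_summable_cmult:
  fixes f :: "'i \<Rightarrow> complex"
  assumes "(\<lambda>i. (cmod (f i))\<^sup>2) summable_on UNIV"
  shows "(\<lambda>i. (cmod (r *\<^sub>R f i))\<^sup>2) summable_on UNIV"
  using summable_on_cmult_right[OF assms, of "r\<^sup>2"] by (simp add: power_mult_distrib)

instantiation ell2 :: (type) real_inner
begin

lift_definition zero_ell2 :: "'a ell2" is "\<lambda>_. 0" by simp

lift_definition plus_ell2 :: "'a ell2 \<Rightarrow> 'a ell2 \<Rightarrow> 'a ell2" is "\<lambda>\<xi> \<eta> i. \<xi> i + \<eta> i"
  by (rule square_summable_add)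

lift_definition uminus_ell2 :: "'a ell2 \<Rightarrow> 'a ell2" is "\<lambda>\<xi> i. - \<xi> i"
  by simp

lift_definition minus_ell2 :: "'a ell2 \<Rightarrow> 'a ell2 \<Rightarrow> 'a ell2" is "\<lambda>\<xi> \<eta> i. \<xi> i - \<eta> i"
  using square_summable_add[of _ "\<lambda>i. - _ i"] by simp

lift_definition scaleR_ell2 :: "real \<Rightarrow> 'a ell2 \<Rightarrow> 'a ell2" is "\<lambda>r \<xi> i. r *\<^sub>R \<xi> i"
  by (rule square_summable_cmult)

text \<open>The real part of the complex inner product: the inner product on \<^typ>\<open>complex\<close> is
  the real part of \<open>z * cnj w\<close>.\<close>

lift_definition inner_ell2 :: "'a ell2 \<Rightarrow> 'a ell2 \<Rightarrow> real"
  is "\<lambda>\<xi> \<eta>. \<Sum>\<^sub>\<infinity>i. inner (\<xi> i) (\<eta> i)" .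

definition norm_ell2 :: "'a ell2 \<Rightarrow> real" where
  "norm_ell2 \<xi> = sqrt (\<Sum>\<^sub>\<infinity>i. (cmod (Rep_ell2 \<xi> i))\<^sup>2)"

definition sgn_ell2 :: "'a ell2 \<Rightarrow> 'a ell2" where
  "sgn_ell2 \<xi> = inverse (norm \<xi>) *\<^sub>R \<xi>"

definition dist_ell2 :: "'a ell2 \<Rightarrow> 'a ell2 \<Rightarrow> real" where
  "dist_ell2 \<xi> \<eta> = norm (\<xi> - \<eta>)"

definition uniformity_ell2 :: "('a ell2 \<times> 'a ell2) filter" where
  "uniformity_ell2 = (INF e\<in>{0<..}. principal {(x, y). dist x y < e})"

definition open_ell2 :: "'a ell2 set \<Rightarrow> bool" where
  "open_ell2 U = (\<forall>x\<in>U. \<forall>\<^sub>F (x', y) in uniformity. x' = x \<longrightarrow> y \<in> U)"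

instance
proof
  fix x y z :: "'a ell2" and r s :: real
  show "x + y + z = x + (y + z)" by transfer (auto simp: algebra_simps)
  show "x + y = y + x" by transfer (auto simp: algebra_simps)
  show "0 + x = x" by transfer auto
  show "- x + x = 0" by transfer auto
  show "x - y = x + - y" by transfer auto
  show "r *\<^sub>R (x + y) = r *\<^sub>R x + r *\<^sub>R y" by transfer (auto simp: scaleR_add_right)
  show "(r + s) *\<^sub>R x = r *\<^sub>R x + s *\<^sub>R x" by transfer (auto simp: scaleR_add_left)
  show "r *\<^sub>R s *\<^sub>R x = (r * s) *\<^sub>R x" by transfer auto
  show "1 *\<^sub>R x = x" by transfer auto
  show "dist x y = norm (x - y)" by (rule dist_ell2_def)
  show "sgn x = inverse (norm x) *\<^sub>R x" by (simp add: sgn_ell2_def)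
  show "uniformity = (INF e\<in>{0<..}. principal {(x, y :: 'a ell2). dist x y < e})"
    by (rule uniformity_ell2_def)
  show "open U = (\<forall>x\<in>U. \<forall>\<^sub>F (x', y) in uniformity. x' = x \<longrightarrow> y \<in> U)" for U :: "'a ell2 set"
    by (rule open_ell2_def)
  show "inner x y = inner y x" by transfer (simp add: inner_commute)
  show "inner (x + y) z = inner x z + inner y z"
    by transfer (simp add: inner_add_left infsum_add square_summable_inner)
  show "inner (r *\<^sub>R x) y = r * inner x y"
    by transfer (simp add: infsum_cmult_right')
  show "0 \<le> inner x x" by transfer (simp add: infsum_nonneg)
  show "inner x x = 0 \<longleftrightarrow> x = 0"
  proof
    assume "inner x x = 0"
    then show "x = 0"
    proof transfer
      fix \<xi> :: "'a \<Rightarrow> complex"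
      assume 1: "(\<lambda>i. (cmod (\<xi> i))\<^sup>2) summable_on UNIV" and 2: "(\<Sum>\<^sub>\<infinity>i. inner (\<xi> i) (\<xi> i)) = 0"
      have "(cmod (\<xi> i))\<^sup>2 = 0" for i
        by (rule nonneg_infsum_le_0D[where A = UNIV])
          (use 1 2 in \<open>auto simp: power2_norm_eq_inner\<close>)
      then show "\<xi> = (\<lambda>_. 0)" by auto
    qed
  qed (transfer, simp)
  show "norm x = sqrt (inner x x)"
    unfolding norm_ell2_def by transfer (simp add: power2_norm_eq_inner)
qed

end

text \<open>Boundedness of weighted composition operators; it shows that the operators defined below
  through \<^const>\<open>Blinfun\<close> and \<^const>\<open>Abs_ell2\<close> take the intended values.\<close>

lemma weighted_composition_bound:
  fixes \<xi> :: "'i ell2"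
  assumes inj: "inj_on p {i. w i \<noteq> 0}" and bd: "\<And>i. cmod (w i) \<le> B"
  shows "(\<lambda>i. (cmod (w i * Rep_ell2 \<xi> (p i)))\<^sup>2) summable_on UNIV" (is ?S)
    and "(\<Sum>\<^sub>\<infinity>i. (cmod (w i * Rep_ell2 \<xi> (p i)))\<^sup>2) \<le> B\<^sup>2 * (\<Sum>\<^sub>\<infinity>i. (cmod (Rep_ell2 \<xi> i))\<^sup>2)" (is ?L)
proof -
  let ?A = "{i. w i \<noteq> 0}"
  let ?h = "\<lambda>i. (cmod (Rep_ell2 \<xi> i))\<^sup>2"
  let ?t = "\<lambda>i. (cmod (w i * Rep_ell2 \<xi> (p i)))\<^sup>2"
  have hp: "?h summable_on (p ` ?A)"
    using ell2_summable by (rule summable_on_subset_banach) simp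
  have sA: "(\<lambda>i. ?h (p i)) summable_on ?A"
    using hp summable_on_reindex[OF inj, of ?h] by (simp add: o_def)
  have le: "?t i \<le> B\<^sup>2 * ?h (p i)" for i
    using bd[of i] by (auto simp: norm_mult power_mult_distrib intro!: mult_right_mono power_mono)
  have sB: "(\<lambda>i. B\<^sup>2 * ?h (p i)) summable_on ?A"
    using sA by (rule summable_on_cmult_right)
  have tA: "?t summable_on ?A"
    by (rule summable_on_comparison_test[OF sB]) (use le in auto)
  show S: ?S
    using tA by (subst summable_on_cong_neutral[where T = ?A and g = ?t]) auto
  have "infsum ?t UNIV = infsum ?t ?A"
    by (rule infsum_cong_neutral) auto
  also have "\<dots> \<le> (\<Sum>\<^sub>\<infinity>i\<in>?A. B\<^sup>2 * ?h (p i))"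
    by (rule infsum_mono[OF tA sB]) (use le in auto)
  also have "\<dots> = B\<^sup>2 * infsum ?h (p ` ?A)"
    using infsum_reindex[OF inj, of ?h] by (simp add: infsum_cmult_right' o_def)
  also have "\<dots> \<le> B\<^sup>2 * infsum ?h UNIV"
    by (intro mult_left_mono infsum_mono_neutral hp ell2_summable) auto
  finally show ?L .
qed

lemma weighted_composition_apply:
  fixes w :: "'i \<Rightarrow> complex" and \<xi> :: "'i ell2"
  assumes inj: "inj_on p {i. w i \<noteq> 0}" and bd: "\<And>i. cmod (w i) \<le> B"
  shows "Rep_ell2 (blinfun_apply (Blinfun (\<lambda>\<xi>. Abs_ell2 (\<lambda>i. w i * Rep_ell2 \<xi> (p i)))) \<xi>)
      = (\<lambda>i. w i * Rep_ell2 \<xi> (p i))"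
proof -
  let ?T = "\<lambda>\<xi>. Abs_ell2 (\<lambda>i. w i * Rep_ell2 \<xi> (p i))"
  have R: "Rep_ell2 (?T \<xi>) = (\<lambda>i. w i * Rep_ell2 \<xi> (p i))" for \<xi>
    using weighted_composition_bound(1)[OF inj bd] by (intro Abs_ell2_inverse) simp
  have B: "0 \<le> B" using bd[of undefined] norm_ge_zero order_trans by blast
  have "bounded_linear ?T"
  proof (rule bounded_linear_intro[where K = B])
    show "?T (x + y) = ?T x + ?T y" for x y
      by (rule Rep_ell2_inject[THEN iffD1], unfold R, unfold plus_ell2.rep_eq R) (simp add: algebra_simps)
    show "?T (r *\<^sub>R x) = r *\<^sub>R ?T x" for r x
      by (rule Rep_ell2_inject[THEN iffD1], unfold R, unfold scaleR_ell2.rep_eq R) simp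
    show "norm (?T x) \<le> norm x * B" for x
      using real_sqrt_le_mono[OF weighted_composition_bound(2)[OF inj bd, of x]] B
      by (simp add: norm_ell2_def R real_sqrt_mult mult.commute)
  qed
  then show ?thesis by (simp add: bounded_linear_Blinfun_apply R)
qed


section \<open>The reduced crossed product of \<open>C(X)\<close> by a discrete group\<close>

definition fun_action ::
    "('g, 'm) monoid_scheme \<Rightarrow> ('g \<Rightarrow> 'x \<Rightarrow> 'x) \<Rightarrow> 'g \<Rightarrow> ('x \<Rightarrow> complex) \<Rightarrow> 'x \<Rightarrow> complex" where
  "fun_action G \<phi> s f = (\<lambda>x. f (\<phi> (inv\<^bsub>G\<^esub> s) x))"

text \<open>The reduced crossed product is realised by the regular representation induced from the
  faithful representation of \<open>C(X)\<close> on \<open>\<ell>\<^sup>2(X)\<close> by multiplication.  It acts on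
  \<open>\<ell>\<^sup>2(\<Gamma>) \<otimes> \<ell>\<^sup>2(X) = \<ell>\<^sup>2(\<Gamma> \<times> X)\<close> by
  \<open>(\<pi>(f) \<xi>)(g, x) = \<alpha>\<^sub>g\<^sup>-\<^sup>1(f)(x) \<xi>(g, x)\<close> (with \<open>\<alpha>\<close> being \<^const>\<open>fun_action\<close>) and \<open>(\<lambda>\<^sub>s \<xi>)(g, x) = \<xi>(s\<^sup>-\<^sup>1 g, x)\<close>,
  so that \<open>\<lambda>\<^sub>s \<pi>(f) \<lambda>\<^sub>s\<^sup>-\<^sup>1 = \<pi>(\<alpha>\<^sub>s(f))\<close>; up to isomorphism the resulting algebra does not depend
  on the choice of the faithful representation.
  Since \<open>\<Gamma>\<close> and \<open>X\<close> are carriers inside types, \<open>\<ell>\<^sup>2(\<Gamma> \<times> X)\<close> is the closed subspace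
  of \<^typ>\<open>('g \<times> 'x) ell2\<close> of the functions supported there, and all operators are extended
  by zero to its orthogonal complement.\<close>

definition cp_fun :: "('g, 'm) monoid_scheme \<Rightarrow> 'x topology \<Rightarrow> ('g \<Rightarrow> 'x \<Rightarrow> 'x) \<Rightarrow>
    ('x \<Rightarrow> complex) \<Rightarrow> ('g \<times> 'x) ell2 \<Rightarrow>\<^sub>L ('g \<times> 'x) ell2" where
  "cp_fun G X \<phi> f = Blinfun (\<lambda>\<xi>. Abs_ell2 (\<lambda>(g, x).
     if g \<in> carrier G \<and> x \<in> topspace X
     then fun_action G \<phi> (inv\<^bsub>G\<^esub> g) f x * Rep_ell2 \<xi> (g, x) else 0))"

definition cp_shift :: "('g, 'm) monoid_scheme \<Rightarrow> 'x topology \<Rightarrow>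
    'g \<Rightarrow> ('g \<times> 'x) ell2 \<Rightarrow>\<^sub>L ('g \<times> 'x) ell2" where
  "cp_shift G X s = Blinfun (\<lambda>\<xi>. Abs_ell2 (\<lambda>(g, x).
     if g \<in> carrier G \<and> x \<in> topspace X
     then Rep_ell2 \<xi> (inv\<^bsub>G\<^esub> s \<otimes>\<^bsub>G\<^esub> g, x) else 0))"

lemma cp_fun_apply:
  assumes "compact_space X" "group_action G (topspace X) \<phi>" "continuous_map X euclidean f"
  shows "Rep_ell2 (blinfun_apply (cp_fun G X \<phi> f) \<xi>) (g, x) =
    (if g \<in> carrier G \<and> x \<in> topspace X then f (\<phi> g x) * Rep_ell2 \<xi> (g, x) else 0)"
proof -
  interpret group_action G "topspace X" \<phi> by fact
  interpret group G using group_hom by (simp add: group_hom_def)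
  have "compact (f ` topspace X)"
    using image_compactin[OF _ assms(3), of "topspace X"] assms(1)
    by (simp add: compact_space_def)
  then obtain B where B: "\<And>y. y \<in> topspace X \<Longrightarrow> cmod (f y) \<le> B"
    by (meson bounded_iff compact_imp_bounded imageI)
  define w where "w = (\<lambda>(g, x). if g \<in> carrier G \<and> x \<in> topspace X
    then fun_action G \<phi> (inv\<^bsub>G\<^esub> g) f x else 0)"
  have w: "cmod (w i) \<le> max 0 B" for i
    using B element_image
    by (auto simp: w_def fun_action_def le_max_iff_disj split: prod.splits)
  have "cp_fun G X \<phi> f = Blinfun (\<lambda>\<xi>. Abs_ell2 (\<lambda>i. w i * Rep_ell2 \<xi> i))"
    unfolding cp_fun_def w_def
    by (intro arg_cong[where f = Blinfun] ext arg_cong[where f = Abs_ell2]) auto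
  then have "Rep_ell2 (blinfun_apply (cp_fun G X \<phi> f) \<xi>) = (\<lambda>i. w i * Rep_ell2 \<xi> i)"
    using weighted_composition_apply[of "\<lambda>i. i" w "max 0 B" \<xi>] w by simp
  then show ?thesis by (simp add: w_def fun_action_def)
qed

lemma cp_shift_apply:
  assumes "group G" "s \<in> carrier G"
  shows "Rep_ell2 (blinfun_apply (cp_shift G X s) \<xi>) (g, x) =
    (if g \<in> carrier G \<and> x \<in> topspace X then Rep_ell2 \<xi> (inv\<^bsub>G\<^esub> s \<otimes>\<^bsub>G\<^esub> g, x) else 0)"
proof -
  interpret group G by fact
  define w :: "'a \<times> 'c \<Rightarrow> complex" where
    "w = (\<lambda>(g, x). if g \<in> carrier G \<and> x \<in> topspace X then 1 else 0)"
  define p :: "'a \<times> 'c \<Rightarrow> 'a \<times> 'c" where "p = (\<lambda>(g, x). (inv\<^bsub>G\<^esub> s \<otimes>\<^bsub>G\<^esub> g, x))"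
  have inj: "inj_on p {i. w i \<noteq> 0}"
    using assms by (auto simp: inj_on_def p_def w_def split: if_splits)
  have w: "cmod (w i) \<le> 1" for i by (auto simp: w_def split: prod.splits)
  have "cp_shift G X s = Blinfun (\<lambda>\<xi>. Abs_ell2 (\<lambda>i. w i * Rep_ell2 \<xi> (p i)))"
    unfolding cp_shift_def w_def p_def
    by (intro arg_cong[where f = Blinfun] ext arg_cong[where f = Abs_ell2]) auto
  then have "Rep_ell2 (blinfun_apply (cp_shift G X s) \<xi>) = (\<lambda>i. w i * Rep_ell2 \<xi> (p i))"
    using weighted_composition_apply[of p w 1 \<xi>] w inj by simp
  then show ?thesis by (simp add: w_def p_def)
qed

definition cp_base :: "('g, 'm) monoid_scheme \<Rightarrow> 'x topology \<Rightarrow> ('g \<Rightarrow> 'x \<Rightarrow> 'x) \<Rightarrow>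
    (('g \<times> 'x) ell2 \<Rightarrow>\<^sub>L ('g \<times> 'x) ell2) set" where
  "cp_base G X \<phi> = {cp_fun G X \<phi> f | f. continuous_map X euclidean f}"

text \<open>The norm closure of the image of the *-algebra of finitely supported functions from
  \<open>\<Gamma>\<close> to \<open>C(X)\<close>.  Operators in \<open>\<Rightarrow>\<^sub>L\<close> are only required to be real-linear, but the generators,
  hence all elements of the closure, are complex-linear, and the operator norm is the usual one.\<close>

definition reduced_crossed_product ::
    "('g, 'm) monoid_scheme \<Rightarrow> 'x topology \<Rightarrow> ('g \<Rightarrow> 'x \<Rightarrow> 'x) \<Rightarrow>
    (('g \<times> 'x) ell2 \<Rightarrow>\<^sub>L ('g \<times> 'x) ell2) set" where
  "reduced_crossed_product G X \<phi> = closure {\<Sum>s\<in>S. cp_fun G X \<phi> (f s) o\<^sub>L cp_shift G X s | S f.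
     finite S \<and> S \<subseteq> carrier G \<and> (\<forall>s\<in>S. continuous_map X euclidean (f s))}"

definition relative_commutant ::
    "('a::real_normed_vector \<Rightarrow>\<^sub>L 'a) set \<Rightarrow> ('a \<Rightarrow>\<^sub>L 'a) set \<Rightarrow> ('a \<Rightarrow>\<^sub>L 'a) set" where
  "relative_commutant D C = {a \<in> C. \<forall>d\<in>D. a o\<^sub>L d = d o\<^sub>L a}"

text \<open>Here \<^term>\<open>invariants (topspace X) \<phi> s\<close> is the fixed point set of \<open>s\<close>.\<close>

definition germ_isotropy ::
    "('g, 'm) monoid_scheme \<Rightarrow> 'x topology \<Rightarrow> ('g \<Rightarrow> 'x \<Rightarrow> 'x) \<Rightarrow> 'x \<Rightarrow> 'g set" where
  "germ_isotropy G X \<phi> x = {s \<in> carrier G. x \<in> X interior_of (invariants (topspace X) \<phi> s)}"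

end

theory Submission
  imports Defs
begin

text \<open>An operator in the crossed product preserves every fibre \<open>\<ell>\<^sup>2(\<Gamma> \<times> {x})\<close>, where its matrix is
  \<open>(g, h) \<mapsto> E\<^bsub>g h\<^sup>-\<^sup>1\<^esub>(a)(g x)\<close> for continuous Fourier coefficients \<open>E\<^bsub>s\<^esub>(a)\<close> on \<open>X\<close>.
  By Urysohn's lemma, if \<open>a\<close> commutes with \<open>C(X)\<close> then \<open>E\<^bsub>s\<^esub>(a)\<close> vanishes off the fixed points of
  \<open>s\<close>, hence, by continuity, off their interior.  So the coefficients at \<open>y\<close> of a product of two
  elements of the relative commutant are obtained by convolution over the group \<open>H\<^sup>y\<close>, which is
  commutative when \<open>H\<^sup>y\<close> is.  Conversely, for \<open>s, t \<in> H\<^sup>x\<close> take a continuous \<open>f\<close> with \<open>f(x) = 1\<close>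
  vanishing off the interiors of the fixed point sets of \<open>s\<close> and \<open>t\<close>; then \<open>f \<lambda>\<^sub>s\<close> and \<open>f \<lambda>\<^sub>t\<close> lie in
  the relative commutant and do not commute unless \<open>s t = t s\<close>.\<close>

section \<open>Coordinates in the Hilbert space\<close>

text \<open>The scalar \<open>z\<close> is an argument because bounded operators here are only
  real-linear: values on the vectors with \<open>z = 1\<close> would not determine them.\<close>

lift_definition ell2_single :: "'i \<Rightarrow> complex \<Rightarrow> 'i ell2" is "\<lambda>i z j. if j = i then z else 0"
proof -
  fix i :: 'i and z :: complex
  show "(\<lambda>j. (cmod (if j = i then z else 0))\<^sup>2) summable_on UNIV"
    by (subst summable_on_cong_neutral[where T = "{i}" and g = "\<lambda>_. (cmod z)\<^sup>2"]) auto
qed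

lemma ell2_eqI: "(\<And>i. Rep_ell2 \<xi> i = Rep_ell2 \<eta> i) \<Longrightarrow> \<xi> = \<eta>"
  by (metis Rep_ell2_inject ext)

lemma norm_ell2_single [simp]: "norm (ell2_single i z) = cmod z"
proof -
  have "(\<Sum>\<^sub>\<infinity>j. (cmod (if j = i then z else 0))\<^sup>2) = (\<Sum>\<^sub>\<infinity>j\<in>{i}. (cmod z)\<^sup>2)"
    by (rule infsum_cong_neutral) auto
  then show ?thesis by (simp add: norm_ell2_def ell2_single.rep_eq)
qed

lemma norm_ell2_power2: "(norm \<xi>)\<^sup>2 = (\<Sum>\<^sub>\<infinity>i. (cmod (Rep_ell2 \<xi> i))\<^sup>2)"
  by (simp add: norm_ell2_def infsum_nonneg)

lemma cmod_Rep_ell2_le: "cmod (Rep_ell2 \<xi> i) \<le> norm \<xi>"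
proof -
  have "(\<Sum>\<^sub>\<infinity>j\<in>{i}. (cmod (Rep_ell2 \<xi> j))\<^sup>2) \<le> (\<Sum>\<^sub>\<infinity>j. (cmod (Rep_ell2 \<xi> j))\<^sup>2)"
    by (rule infsum_mono_neutral) (auto simp: ell2_summable)
  then have "(cmod (Rep_ell2 \<xi> i))\<^sup>2 \<le> (norm \<xi>)\<^sup>2"
    by (simp add: norm_ell2_power2)
  then show ?thesis by (rule power2_le_imp_le) simp
qed

lemma bounded_linear_Rep_ell2: "bounded_linear (\<lambda>\<xi>. Rep_ell2 \<xi> i)"
  by (rule bounded_linear_intro[where K = 1])
    (auto simp: plus_ell2.rep_eq scaleR_ell2.rep_eq cmod_Rep_ell2_le)

lemma Rep_ell2_sum: "Rep_ell2 (sum f S) i = (\<Sum>s\<in>S. Rep_ell2 (f s) i)"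
  using linear_sum[OF bounded_linear.linear[OF bounded_linear_Rep_ell2]] .

text \<open>The squared distance from a finite partial sum to \<open>\<xi>\<close> is the tail of
  the convergent series of squared moduli, so it tends to 0.\<close>

lemma has_sum_ell2_single: "((\<lambda>i. ell2_single i (Rep_ell2 \<xi> i)) has_sum \<xi>) UNIV"
proof -
  let ?h = "\<lambda>i. (cmod (Rep_ell2 \<xi> i))\<^sup>2"
  let ?S = "\<lambda>F. \<Sum>i\<in>F. ell2_single i (Rep_ell2 \<xi> i)"
  have coord: "Rep_ell2 (?S F) j = (if j \<in> F then Rep_ell2 \<xi> j else 0)" if "finite F" for F j
    using that by (simp add: Rep_ell2_sum ell2_single.rep_eq)
  have dist: "(norm (?S F - \<xi>))\<^sup>2 = infsum ?h UNIV - sum ?h F" if F: "finite F" for F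
  proof -
    have "(norm (?S F - \<xi>))\<^sup>2 = infsum ?h (UNIV - F)"
      unfolding norm_ell2_power2
      by (rule infsum_cong_neutral) (auto simp: minus_ell2.rep_eq coord F)
    also have "\<dots> = infsum ?h UNIV - infsum ?h F"
      by (rule infsum_Diff) (use F ell2_summable in auto)
    finally show ?thesis using F by simp
  qed
  have "(?h has_sum infsum ?h UNIV) UNIV"
    using ell2_summable by (rule has_sum_infsum)
  then have "((\<lambda>F. infsum ?h UNIV - sum ?h F) \<longlongrightarrow> infsum ?h UNIV - infsum ?h UNIV)
      (finite_subsets_at_top UNIV)"
    unfolding has_sum_def by (intro tendsto_intros)
  then have "((\<lambda>F. (norm (?S F - \<xi>))\<^sup>2) \<longlongrightarrow> 0) (finite_subsets_at_top UNIV)"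
    by (rule Lim_transform_eventually[OF tendsto_eq_rhs])
      (auto intro!: eventually_finite_subsets_at_top_weakI simp: dist)
  then have "((\<lambda>F. sqrt ((norm (?S F - \<xi>))\<^sup>2)) \<longlongrightarrow> sqrt 0) (finite_subsets_at_top UNIV)"
    by (rule tendsto_real_sqrt)
  then show ?thesis
    unfolding has_sum_def by (subst Lim_null) (simp add: tendsto_norm_zero_iff)
qed

text \<open>A bounded operator may be applied termwise to the basis expansion. This makes its matrix
  entries determine it and turns composition into matrix multiplication.\<close>

lemma has_sum_blinfun_ell2:
  fixes T :: "'i ell2 \<Rightarrow>\<^sub>L 'j ell2"
  shows "((\<lambda>i. Rep_ell2 (T (ell2_single i (Rep_ell2 \<xi> i))) j) has_sum Rep_ell2 (T \<xi>) j) UNIV"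
  by (rule has_sum_bounded_linear[OF bounded_linear_compose[OF bounded_linear_Rep_ell2
        blinfun.bounded_linear_right] has_sum_ell2_single])

lemma blinfun_ell2_eqI:
  fixes T U :: "'i ell2 \<Rightarrow>\<^sub>L 'j ell2"
  assumes "\<And>i z. T (ell2_single i z) = U (ell2_single i z)"
  shows "T = U"
proof (rule blinfun_eqI, rule ell2_eqI)
  fix \<xi> j
  show "Rep_ell2 (T \<xi>) j = Rep_ell2 (U \<xi>) j"
    using has_sum_blinfun_ell2[of T \<xi> j] has_sum_blinfun_ell2[of U \<xi> j]
    unfolding assms by (rule has_sum_unique)
qed

lemma bounded_linear_blinfun_coordinate:
  fixes \<xi> :: "'i ell2"
  shows "bounded_linear (\<lambda>T :: 'i ell2 \<Rightarrow>\<^sub>L 'j ell2. Rep_ell2 (T \<xi>) j)"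
  by (rule bounded_linear_compose[OF bounded_linear_Rep_ell2 blinfun.bounded_linear_left])

section \<open>Fourier coefficients in the crossed product\<close>

text \<open>The set where \<open>f\<close> does not vanish is open and contained in
  \<open>F\<close>.\<close>

lemma subset_interior_of_nonzero:
  fixes f :: "'x \<Rightarrow> complex"
  assumes "continuous_map X euclidean f"
    and "\<And>y. y \<in> topspace X \<Longrightarrow> f y \<noteq> 0 \<Longrightarrow> y \<in> F"
    and "x \<in> topspace X" "f x \<noteq> 0"
  shows "x \<in> X interior_of F"
proof -
  have "openin X {y \<in> topspace X. f y \<in> - {0}}"
    by (rule openin_continuous_map_preimage[OF assms(1)]) auto
  then show ?thesis
    unfolding interior_of_def using assms(2-4) by blast
qed

text \<open>Compact Hausdorff spaces are normal, so the closed sets {x} and X minus \<open>W\<close>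
  can be separated by a real function, which is then read as complex-valued.\<close>

lemma Urysohn_point:
  assumes "compact_space X" "Hausdorff_space X" "openin X W" "x \<in> W"
  obtains f where "continuous_map X euclidean f" "f x = (1 :: complex)"
    "\<And>y. y \<in> topspace X \<Longrightarrow> y \<notin> W \<Longrightarrow> f y = 0"
proof -
  have x: "x \<in> topspace X" using assms openin_subset by blast
  have "closedin X {x}"
    using assms x by (simp add: closedin_Hausdorff_sing_eq)
  moreover have "closedin X (topspace X - W)"
    using assms by blast
  ultimately obtain f where f: "continuous_map X euclideanreal f"
      "f ` (topspace X - W) \<subseteq> {0}" "f ` {x} \<subseteq> {1}"
    using Urysohn_lemma_alt[of X "topspace X - W" "{x}" 0 1] assms
      compact_Hausdorff_or_regular_imp_normal_space by (auto simp: disjnt_def)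
  show thesis
  proof (rule that)
    show "continuous_map X euclidean (\<lambda>y. complex_of_real (f y))"
      using f(1) by (rule continuous_map_compose[of X euclideanreal f euclidean complex_of_real, unfolded o_def])
        (simp add: continuous_intros)
  qed (use f in auto)
qed

locale compact_hausdorff_action = group_action G "topspace X" \<phi>
  for G :: "('g, 'm) monoid_scheme" (structure) and X :: "'x topology" and \<phi> +
  assumes compact: "compact_space X"
    and hausdorff: "Hausdorff_space X"
begin

sublocale group G
  using group_hom by (simp add: group_hom_def)

abbreviation "cp_algebra \<equiv> reduced_crossed_product G X \<phi>"
abbreviation "cp_commutant \<equiv> relative_commutant (cp_base G X \<phi>) cp_algebra"

text \<open>The matrix entry in row (1, y) and column (\<open>inv s\<close>, y). Since the shift by
  \<open>s\<close> moves the basis vector at \<open>inv s\<close> to the one at 1, this is the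
  coefficient function of \<open>s\<close> when \<open>a\<close> is a finite sum.\<close>

definition fourier_coeff ::
    "(('g \<times> 'x) ell2 \<Rightarrow>\<^sub>L ('g \<times> 'x) ell2) \<Rightarrow> 'g \<Rightarrow> 'x \<Rightarrow> complex" where
  "fourier_coeff a s y = Rep_ell2 (a (ell2_single (inv s, y) 1)) (\<one>, y)"

lemma act_in: "g \<in> carrier G \<Longrightarrow> x \<in> topspace X \<Longrightarrow> \<phi> g x \<in> topspace X"
  using element_image by blast

lemma act_one: "x \<in> topspace X \<Longrightarrow> \<phi> \<one> x = x"
  by (metis id_eq_one restrict_apply')

lemma generator_apply:
  assumes "continuous_map X euclidean f" "s \<in> carrier G"
  shows "Rep_ell2 ((cp_fun G X \<phi> f o\<^sub>L cp_shift G X s) \<xi>) (g, x) =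
    (if g \<in> carrier G \<and> x \<in> topspace X then f (\<phi> g x) * Rep_ell2 \<xi> (inv s \<otimes> g, x) else 0)"
  by (simp add: cp_fun_apply[OF compact group_action_axioms assms(1)]
      cp_shift_apply[OF is_group assms(2)])

lemma generator_in_algebra:
  assumes "continuous_map X euclidean f" "s \<in> carrier G"
  shows "cp_fun G X \<phi> f o\<^sub>L cp_shift G X s \<in> cp_algebra"
  unfolding reduced_crossed_product_def
  by (rule subsetD[OF closure_subset], rule CollectI, rule exI[of _ "{s}"], rule exI[of _ "\<lambda>_. f"])
    (use assms in auto)

definition finite_sums :: "(('g \<times> 'x) ell2 \<Rightarrow>\<^sub>L ('g \<times> 'x) ell2) set" where
  "finite_sums = {\<Sum>s\<in>S. cp_fun G X \<phi> (f s) o\<^sub>L cp_shift G X s | S f.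
     finite S \<and> S \<subseteq> carrier G \<and> (\<forall>s\<in>S. continuous_map X euclidean (f s))}"

lemma algebra_eq: "cp_algebra = closure finite_sums"
  by (simp add: reduced_crossed_product_def finite_sums_def)

text \<open>Only the summand with s h = g can carry the basis vector at h to row g, and no summand
  changes the point of X.\<close>

lemma finite_sum_single:
  assumes "finite S" "S \<subseteq> carrier G" "\<And>s. s \<in> S \<Longrightarrow> continuous_map X euclidean (f s)"
  shows "Rep_ell2 ((\<Sum>s\<in>S. cp_fun G X \<phi> (f s) o\<^sub>L cp_shift G X s) (ell2_single (h, y) z)) (g, x) =
    (if g \<in> carrier G \<and> h \<in> carrier G \<and> x \<in> topspace X \<and> y = x \<and> g \<otimes> inv h \<in> S
     then f (g \<otimes> inv h) (\<phi> g x) * z else 0)"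
    (is "?l = ?r")
proof -
  have "?l = (\<Sum>s\<in>S. if g \<in> carrier G \<and> x \<in> topspace X
      then f s (\<phi> g x) * Rep_ell2 (ell2_single (h, y) z) (inv s \<otimes> g, x) else 0)"
    unfolding blinfun.sum_left Rep_ell2_sum
    by (intro sum.cong refl generator_apply) (use assms in auto)
  also have "\<dots> = (\<Sum>s\<in>S. if s = g \<otimes> inv h
      then if g \<in> carrier G \<and> h \<in> carrier G \<and> x \<in> topspace X \<and> y = x
        then f (g \<otimes> inv h) (\<phi> g x) * z else 0 else 0)"
  proof (rule sum.cong[OF refl])
    fix s assume "s \<in> S"
    then have s: "s \<in> carrier G" using assms by auto
    have "inv s \<otimes> g = h \<longleftrightarrow> h \<in> carrier G \<and> s = g \<otimes> inv h" if "g \<in> carrier G"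
    proof -
      have "inv s \<otimes> g = h \<longleftrightarrow> g = s \<otimes> h" if "h \<in> carrier G"
        using that s \<open>g \<in> carrier G\<close> by (metis inv_solve_left)
      moreover have "g = s \<otimes> h \<longleftrightarrow> s = g \<otimes> inv h" if "h \<in> carrier G"
        using that s \<open>g \<in> carrier G\<close> by (metis inv_solve_right)
      ultimately show ?thesis using s that by auto
    qed
    then show "(if g \<in> carrier G \<and> x \<in> topspace X
        then f s (\<phi> g x) * Rep_ell2 (ell2_single (h, y) z) (inv s \<otimes> g, x) else 0) =
      (if s = g \<otimes> inv h
      then if g \<in> carrier G \<and> h \<in> carrier G \<and> x \<in> topspace X \<and> y = x
        then f (g \<otimes> inv h) (\<phi> g x) * z else 0 else 0)"
      by (auto simp: ell2_single.rep_eq)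
  qed
  also have "\<dots> = ?r"
    using assms(1) by (simp add: sum.delta)
  finally show ?thesis .
qed

lemma fourier_coeff_finite_sum:
  assumes "finite S" "S \<subseteq> carrier G" "\<And>s. s \<in> S \<Longrightarrow> continuous_map X euclidean (f s)"
    and "t \<in> carrier G" "y \<in> topspace X"
  shows "fourier_coeff (\<Sum>s\<in>S. cp_fun G X \<phi> (f s) o\<^sub>L cp_shift G X s) t y =
    (if t \<in> S then f t y else 0)"
  unfolding fourier_coeff_def
  by (subst finite_sum_single[OF assms(1-3)]) (use assms in \<open>auto simp: act_one\<close>)

text \<open>For fixed indices both sides are norm-continuous in \<open>a\<close>, the coefficient
  being itself a matrix entry. The identity therefore passes from finite sums to their
  closure.\<close>

lemma algebra_entry:
  assumes "a \<in> cp_algebra"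
  shows "Rep_ell2 (a (ell2_single (h, y) z)) (g, x) =
    (if g \<in> carrier G \<and> h \<in> carrier G \<and> x \<in> topspace X \<and> y = x
     then fourier_coeff a (g \<otimes> inv h) (\<phi> g x) * z else 0)"
proof -
  have cont: "continuous_on UNIV (\<lambda>a :: ('g \<times> 'x) ell2 \<Rightarrow>\<^sub>L ('g \<times> 'x) ell2. Rep_ell2 (a \<xi>) i)" for \<xi> i
    by (rule linear_continuous_on[OF bounded_linear_blinfun_coordinate])
  let ?C = "{a. Rep_ell2 (blinfun_apply a (ell2_single (h, y) z)) (g, x) =
    (if g \<in> carrier G \<and> h \<in> carrier G \<and> x \<in> topspace X \<and> y = x
     then fourier_coeff a (g \<otimes> inv h) (\<phi> g x) * z else 0)}"
  have "closed ?C"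
    unfolding fourier_coeff_def
    by (cases "g \<in> carrier G \<and> h \<in> carrier G \<and> x \<in> topspace X \<and> y = x")
      (simp_all only: if_True if_False, auto intro!: closed_Collect_eq cont continuous_intros)
  moreover have "finite_sums \<subseteq> ?C"
  proof
    fix b assume "b \<in> finite_sums"
    then obtain S f where b: "b = (\<Sum>s\<in>S. cp_fun G X \<phi> (f s) o\<^sub>L cp_shift G X s)"
      and S: "finite S" "S \<subseteq> carrier G" "\<And>s. s \<in> S \<Longrightarrow> continuous_map X euclidean (f s)"
      unfolding finite_sums_def by blast
    show "b \<in> ?C"
      using finite_sum_single[where h = h and y = y and z = z and g = g and x = x, OF S]
      by (auto simp: b fourier_coeff_finite_sum[OF S] act_in)
  qed
  ultimately show ?thesis
    using assms closure_minimal unfolding algebra_eq by blast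
qed

text \<open>Coefficients are entries at unit vectors, so they differ by at most the operator norm of
  the difference. Norm approximation by finite sums thus gives a uniform limit of continuous
  functions.\<close>

lemma continuous_fourier_coeff:
  assumes "a \<in> cp_algebra" "s \<in> carrier G"
  shows "continuous_map X euclidean (fourier_coeff a s)"
proof -
  obtain b where b: "\<And>n. b n \<in> finite_sums" and lim: "b \<longlonglongrightarrow> a"
    using assms(1) unfolding algebra_eq closure_sequential by blast
  \<comment> \<open>\<open>Met_TC\<close> is the metric of the type class; its topology is the
    euclidean one, and the uniform limit theorem is phrased for it.\<close>
  have "continuous_map X Met_TC.mtopology (fourier_coeff a s)"
  proof (rule Met_TC.continuous_map_uniform_limit_alt[where F = sequentially and f = "\<lambda>n. fourier_coeff (b n) s"])
    have "continuous_map X euclidean (fourier_coeff (b n) s)" for n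
    proof -
      obtain S f where bn: "b n = (\<Sum>s\<in>S. cp_fun G X \<phi> (f s) o\<^sub>L cp_shift G X s)"
        and S: "finite S" "S \<subseteq> carrier G" "\<And>s. s \<in> S \<Longrightarrow> continuous_map X euclidean (f s)"
        using b[of n] unfolding finite_sums_def by blast
      have "continuous_map X euclidean (\<lambda>y. if s \<in> S then f s y else 0)"
        using S(3) by (cases "s \<in> S") auto
      then show ?thesis
        by (rule continuous_map_eq)
          (simp add: bn fourier_coeff_finite_sum[OF S assms(2)])
    qed
    then show "\<forall>\<^sub>F n in sequentially. continuous_map X Met_TC.mtopology (fourier_coeff (b n) s)"
      by (simp add: mtopology_is_euclidean)
    fix \<epsilon> :: real assume "0 < \<epsilon>"
    then have "\<forall>\<^sub>F n in sequentially. dist (b n) a < \<epsilon>"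
      using lim by (simp add: tendsto_iff)
    then show "\<forall>\<^sub>F n in sequentially. \<forall>x\<in>topspace X.
        dist (fourier_coeff (b n) s x) (fourier_coeff a s x) < \<epsilon>"
    proof eventually_elim
      case (elim n)
      have "dist (fourier_coeff (b n) s x) (fourier_coeff a s x) \<le> norm (b n - a)" for x
      proof -
        let ?\<delta> = "ell2_single (inv s, x) 1"
        have "dist (fourier_coeff (b n) s x) (fourier_coeff a s x) =
            cmod (Rep_ell2 ((b n - a) ?\<delta>) (\<one>, x))"
          by (simp add: fourier_coeff_def dist_norm blinfun.diff_left minus_ell2.rep_eq)
        also have "\<dots> \<le> norm ((b n - a) ?\<delta>)"
          by (rule cmod_Rep_ell2_le)
        also have "\<dots> \<le> norm (b n - a)"
          using norm_blinfun[of "b n - a" ?\<delta>] by simp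
        finally show ?thesis .
      qed
      then show ?case
        using elim by (auto simp: dist_norm intro: le_less_trans)
    qed
  qed auto
  then show ?thesis by (simp add: mtopology_is_euclidean)
qed

section \<open>Coefficients of the relative commutant\<close>

text \<open>Points fixed by s and t are fixed by s t, and points fixed by s are fixed by its
  inverse. These inclusions survive taking interiors, which commutes with finite
  intersections.\<close>

lemma subgroup_germ_isotropy:
  assumes "x \<in> topspace X"
  shows "subgroup (germ_isotropy G X \<phi> x) G"
proof
  show "germ_isotropy G X \<phi> x \<subseteq> carrier G"
    by (auto simp: germ_isotropy_def)
  have "invariants (topspace X) \<phi> \<one> = topspace X"
    by (auto simp: invariants_def act_one)
  then show "\<one> \<in> germ_isotropy G X \<phi> x"
    using assms by (simp add: germ_isotropy_def)
next
  fix s t assume s: "s \<in> germ_isotropy G X \<phi> x" and t: "t \<in> germ_isotropy G X \<phi> x"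
  then have "invariants (topspace X) \<phi> s \<inter> invariants (topspace X) \<phi> t \<subseteq>
      invariants (topspace X) \<phi> (s \<otimes> t)"
    by (auto simp: invariants_def germ_isotropy_def composition_rule)
  then have "X interior_of (invariants (topspace X) \<phi> s \<inter> invariants (topspace X) \<phi> t) \<subseteq>
      X interior_of (invariants (topspace X) \<phi> (s \<otimes> t))"
    by (rule interior_of_mono)
  then show "s \<otimes> t \<in> germ_isotropy G X \<phi> x"
    using s t by (auto simp: germ_isotropy_def interior_of_Int)
next
  fix s assume s: "s \<in> germ_isotropy G X \<phi> x"
  then have "invariants (topspace X) \<phi> s \<subseteq> invariants (topspace X) \<phi> (inv s)"
    by (auto simp: invariants_def germ_isotropy_def intro: orbit_sym_aux)
  then have "X interior_of (invariants (topspace X) \<phi> s) \<subseteq>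
      X interior_of (invariants (topspace X) \<phi> (inv s))"
    by (rule interior_of_mono)
  then show "inv s \<in> germ_isotropy G X \<phi> x"
    using s by (auto simp: germ_isotropy_def)
qed

lemma germ_isotropy_carrier: "s \<in> germ_isotropy G X \<phi> x \<Longrightarrow> s \<in> carrier G"
  by (simp add: germ_isotropy_def)

lemma germ_isotropy_fixes: "s \<in> germ_isotropy G X \<phi> x \<Longrightarrow> \<phi> s x = x"
  using interior_of_subset[of X "invariants (topspace X) \<phi> s"]
  by (auto simp: germ_isotropy_def invariants_def)

lemma commutant_in_algebra: "a \<in> cp_commutant \<Longrightarrow> a \<in> cp_algebra"
  by (simp add: relative_commutant_def)

text \<open>Comparing the entries of a d and d a in row (1, y), column (\<open>inv s\<close>, y)
  gives E d(\<open>inv s\<close> y) = d(y) E, where E is the coefficient. If \<open>s\<close> moved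
  y, some d would take the values 0 and 1 there, forcing E = 0.\<close>

lemma commutant_coeff_fixes:
  assumes a: "a \<in> cp_commutant" and s: "s \<in> carrier G" and y: "y \<in> topspace X"
    and nz: "fourier_coeff a s y \<noteq> 0"
  shows "\<phi> s y = y"
proof (rule ccontr)
  assume ne: "\<phi> s y \<noteq> y"
  \<comment> \<open>The column index is \<open>inv s\<close>, so the points to separate are y and
    its image under \<open>inv s\<close>, not under \<open>s\<close>.\<close>
  have ne': "\<phi> (inv s) y \<noteq> y"
  proof
    assume "\<phi> (inv s) y = y"
    then show False using orbit_sym_aux[of "inv s" y y] s y ne by simp
  qed
  have "openin X (topspace X - {\<phi> (inv s) y})"
    using closedin_Hausdorff_sing_eq[OF hausdorff] act_in s y by blast
  then obtain f :: "'x \<Rightarrow> complex" where f: "continuous_map X euclidean f" "f y = 1" "f (\<phi> (inv s) y) = 0"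
    using Urysohn_point[OF compact hausdorff, of "topspace X - {\<phi> (inv s) y}" y] ne' s y act_in
    by (metis DiffD2 DiffI insertI1 inv_closed singletonD)
  let ?d = "cp_fun G X \<phi> f" and ?\<delta> = "ell2_single (inv s, y) 1"
  have "?d \<in> cp_base G X \<phi>" using f(1) by (auto simp: cp_base_def)
  then have "a o\<^sub>L ?d = ?d o\<^sub>L a" using a by (simp add: relative_commutant_def)
  then have "Rep_ell2 (a (?d ?\<delta>)) (\<one>, y) = Rep_ell2 (?d (a ?\<delta>)) (\<one>, y)"
    by (metis blinfun_apply_blinfun_compose)
  moreover have "?d ?\<delta> = 0"
    by (rule ell2_eqI, clarify)
      (simp add: cp_fun_apply[OF compact group_action_axioms f(1)] ell2_single.rep_eq zero_ell2.rep_eq f(3))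
  moreover have "Rep_ell2 (?d (a ?\<delta>)) (\<one>, y) = fourier_coeff a s y"
    using f(2) y by (simp add: cp_fun_apply[OF compact group_action_axioms f(1)] fourier_coeff_def act_one)
  ultimately show False using nz by (simp add: zero_ell2.rep_eq blinfun.zero_right)
qed

text \<open>Continuity of the coefficient upgrades fixing the single point \<open>y\<close> to
  fixing a whole neighbourhood of it.\<close>

lemma commutant_coeff_support:
  assumes "a \<in> cp_commutant" "s \<in> carrier G" "y \<in> topspace X" "fourier_coeff a s y \<noteq> 0"
  shows "s \<in> germ_isotropy G X \<phi> y"
proof -
  have "y \<in> X interior_of invariants (topspace X) \<phi> s"
  proof (rule subset_interior_of_nonzero)
    show "continuous_map X euclidean (fourier_coeff a s)"
      using assms by (intro continuous_fourier_coeff commutant_in_algebra)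
    show "x \<in> invariants (topspace X) \<phi> s" if "x \<in> topspace X" "fourier_coeff a s x \<noteq> 0" for x
      using commutant_coeff_fixes[OF assms(1,2) that] that(1) by (simp add: invariants_def)
  qed (use assms in auto)
  then show ?thesis using assms(2) by (simp add: germ_isotropy_def)
qed

section \<open>Products in the relative commutant as convolutions\<close>

text \<open>Matrix multiplication: the image under \<open>b\<close> is expanded in basis vectors and
  \<open>a\<close> is applied termwise. Entries between different points of X vanish, which leaves a
  sum over the group.\<close>

lemma has_sum_product_entry:
  assumes "a \<in> cp_algebra" "b \<in> cp_algebra"
  shows "((\<lambda>(k, x'). if g \<in> carrier G \<and> h \<in> carrier G \<and> x \<in> topspace X \<and> y = x \<and> k \<in> carrier G \<and> x' = x
      then fourier_coeff a (g \<otimes> inv k) (\<phi> g x) * (fourier_coeff b (k \<otimes> inv h) (\<phi> k x) * z) else 0)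
    has_sum Rep_ell2 (a (b (ell2_single (h, y) z))) (g, x)) UNIV"
proof -
  have "Rep_ell2 (a (ell2_single i (Rep_ell2 (b (ell2_single (h, y) z)) i))) (g, x) =
    (case i of (k, x') \<Rightarrow> if g \<in> carrier G \<and> h \<in> carrier G \<and> x \<in> topspace X \<and> y = x \<and> k \<in> carrier G \<and> x' = x
      then fourier_coeff a (g \<otimes> inv k) (\<phi> g x) * (fourier_coeff b (k \<otimes> inv h) (\<phi> k x) * z) else 0)" for i
  proof (cases i)
    case (Pair k x')
    show ?thesis
      unfolding Pair prod.case algebra_entry[OF assms(1)] algebra_entry[OF assms(2)]
      by (simp only: mult_zero_right if_cancel split: if_split) blast
  qed
  then show ?thesis
    using has_sum_blinfun_ell2[of a "b (ell2_single (h, y) z)" "(g, x)"] by (simp only:)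
qed

text \<open>Substitute s = g \<open>inv k\<close> in the matrix product. The coefficient of
  \<open>a\<close> kills all s outside the germ isotropy group at g x, and for s inside it both
  coefficients are evaluated at the same point g x.\<close>

lemma has_sum_commutant_product:
  assumes a: "a \<in> cp_commutant" and b: "b \<in> cp_commutant"
    and g: "g \<in> carrier G" and h: "h \<in> carrier G" and x: "x \<in> topspace X"
  shows "((\<lambda>s. fourier_coeff a s (\<phi> g x) * (fourier_coeff b (inv s \<otimes> (g \<otimes> inv h)) (\<phi> g x) * z))
    has_sum Rep_ell2 (a (b (ell2_single (h, x) z))) (g, x)) (germ_isotropy G X \<phi> (\<phi> g x))"
proof -
  let ?H = "germ_isotropy G X \<phi> (\<phi> g x)"
  let ?F = "\<lambda>(k, x'). if g \<in> carrier G \<and> h \<in> carrier G \<and> x \<in> topspace X \<and> x = x \<and> k \<in> carrier G \<and> x' = x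
      then fourier_coeff a (g \<otimes> inv k) (\<phi> g x) * (fourier_coeff b (k \<otimes> inv h) (\<phi> k x) * z) else 0"
  let ?j = "\<lambda>s. (inv s \<otimes> g, x)"
  have inj: "inj_on ?j ?H"
    using g by (auto simp: inj_on_def germ_isotropy_carrier intro: inj_onD[OF inv_inj])
  have outside: "?F i = 0" if "i \<notin> ?j ` ?H" for i
  proof (rule ccontr)
    assume nz: "?F i \<noteq> 0"
    obtain k where i: "i = (k, x)" and k: "k \<in> carrier G"
      and c: "fourier_coeff a (g \<otimes> inv k) (\<phi> g x) \<noteq> 0"
      using nz by (auto split: prod.splits if_splits)
    have "g \<otimes> inv k \<in> ?H"
      using commutant_coeff_support[OF a _ _ c] g k x act_in by simp
    moreover have "inv (g \<otimes> inv k) \<otimes> g = k"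
      using g k by (simp add: inv_mult_group m_assoc)
    ultimately show False using that i by force
  qed
  have inside: "?F (?j s) = fourier_coeff a s (\<phi> g x) * (fourier_coeff b (inv s \<otimes> (g \<otimes> inv h)) (\<phi> g x) * z)"
    if "s \<in> ?H" for s
  proof -
    have s: "s \<in> carrier G" using that by (rule germ_isotropy_carrier)
    \<comment> \<open>The second coefficient sits at k x with k = \<open>inv s \<otimes> g\<close>;
      this point is g x because s fixes g x.\<close>
    have "\<phi> (inv s \<otimes> g) x = \<phi> (inv s) (\<phi> g x)"
      using s g x by (simp add: composition_rule)
    also have "\<dots> = \<phi> g x"
      using orbit_sym_aux[OF s act_in[OF g x] germ_isotropy_fixes[OF that]] .
    finally show ?thesis
      using s g h x by (simp add: inv_mult_group m_assoc[symmetric])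
  qed
  have "(?F has_sum Rep_ell2 (a (b (ell2_single (h, x) z))) (g, x)) (?j ` ?H)"
    by (subst has_sum_cong_neutral[where T = UNIV and g = ?F])
      (use outside has_sum_product_entry[OF commutant_in_algebra[OF a] commutant_in_algebra[OF b],
          of g h x x z] in auto)
  then have "((?F \<circ> ?j) has_sum Rep_ell2 (a (b (ell2_single (h, x) z))) (g, x)) ?H"
    by (subst (asm) has_sum_reindex[OF inj])
  then show ?thesis
    by (rule has_sum_cong[THEN iffD1, rotated]) (use inside in auto)
qed

text \<open>Both products have entries given by convolution over the same group \<open>?H\<close>.
  When that group is abelian, the substitution of \<open>inv s \<otimes> ?r\<close> for s exchanges
  the two factors.\<close>

lemma commutant_commute:
  assumes comm: "\<And>x s t. \<lbrakk>x \<in> topspace X; s \<in> germ_isotropy G X \<phi> x; t \<in> germ_isotropy G X \<phi> x\<rbrakk>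
      \<Longrightarrow> s \<otimes> t = t \<otimes> s"
    and a: "a \<in> cp_commutant" and b: "b \<in> cp_commutant"
  shows "a o\<^sub>L b = b o\<^sub>L a"
proof (rule blinfun_ell2_eqI, rule ell2_eqI, clarsimp)
  fix h y z g x
  note aA = commutant_in_algebra[OF a] and bA = commutant_in_algebra[OF b]
  show "Rep_ell2 (a (b (ell2_single (h, y) z))) (g, x) =
    Rep_ell2 (b (a (ell2_single (h, y) z))) (g, x)"
  proof (cases "g \<in> carrier G \<and> h \<in> carrier G \<and> x \<in> topspace X \<and> y = x")
    case False
    then have "((\<lambda>_. 0) has_sum Rep_ell2 (a (b (ell2_single (h, y) z))) (g, x)) (UNIV :: ('g \<times> 'x) set)"
      "((\<lambda>_. 0) has_sum Rep_ell2 (b (a (ell2_single (h, y) z))) (g, x)) (UNIV :: ('g \<times> 'x) set)"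
      using has_sum_product_entry[OF aA bA, of g h x y z] has_sum_product_entry[OF bA aA, of g h x y z]
      by (auto simp: case_prod_unfold)
    then show ?thesis by (rule has_sum_unique)
  next
    case True
    then have g: "g \<in> carrier G" and h: "h \<in> carrier G" and x: "x \<in> topspace X" and y: "y = x" by auto
    let ?y = "\<phi> g x" and ?r = "g \<otimes> inv h"
    let ?H = "germ_isotropy G X \<phi> ?y"
    have r: "?r \<in> carrier G" and yX: "?y \<in> topspace X"
      using g h x act_in by auto
    interpret H: subgroup ?H G
      by (rule subgroup_germ_isotropy[OF yX])
    have ab: "((\<lambda>s. fourier_coeff a s ?y * (fourier_coeff b (inv s \<otimes> ?r) ?y * z))
      has_sum Rep_ell2 (a (b (ell2_single (h, y) z))) (g, x)) ?H"
      using has_sum_commutant_product[OF a b g h x, of z] y by simp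
    have ba: "((\<lambda>s. fourier_coeff b s ?y * (fourier_coeff a (inv s \<otimes> ?r) ?y * z))
      has_sum Rep_ell2 (b (a (ell2_single (h, y) z))) (g, x)) ?H"
      using has_sum_commutant_product[OF b a g h x, of z] y by simp
    show ?thesis
    proof (cases "?r \<in> ?H")
      case False
      \<comment> \<open>If \<open>?r\<close> lies outside the subgroup, so does
        \<open>inv s \<otimes> ?r\<close> for s inside it; hence the second factor of every term
        vanishes.\<close>
      have z: "fourier_coeff c (inv s \<otimes> ?r) ?y = 0" if "c \<in> cp_commutant" "s \<in> ?H" for c s
      proof (rule ccontr)
        assume "fourier_coeff c (inv s \<otimes> ?r) ?y \<noteq> 0"
        then have "inv s \<otimes> ?r \<in> ?H"
          using commutant_coeff_support[OF that(1) _ yX] that(2) r germ_isotropy_carrier by simp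
        then have "s \<otimes> (inv s \<otimes> ?r) \<in> ?H" using that(2) by simp
        moreover have "s \<otimes> (inv s \<otimes> ?r) = ?r"
          using r germ_isotropy_carrier[OF that(2)] by (simp add: m_assoc[symmetric])
        ultimately show False using False by simp
      qed
      have "((\<lambda>_. 0) has_sum Rep_ell2 (a (b (ell2_single (h, y) z))) (g, x)) ?H"
        using ab by (rule has_sum_cong[THEN iffD1, rotated]) (simp add: z b)
      moreover have "((\<lambda>_. 0) has_sum Rep_ell2 (b (a (ell2_single (h, y) z))) (g, x)) ?H"
        using ba by (rule has_sum_cong[THEN iffD1, rotated]) (simp add: z a)
      ultimately show ?thesis by (rule has_sum_unique)
    next
      case rH: True
      \<comment> \<open>The substitution is its own inverse on \<open>?H\<close>; this is where
        commutativity of the isotropy group enters.\<close>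
      have invol: "inv (inv s \<otimes> ?r) \<otimes> ?r = s" if "s \<in> ?H" for s
      proof -
        have "inv (inv s \<otimes> ?r) \<otimes> ?r = inv ?r \<otimes> (s \<otimes> ?r)"
          using germ_isotropy_carrier[OF that] r by (simp only: inv_mult_group inv_inv m_assoc inv_closed m_closed)
        also have "s \<otimes> ?r = ?r \<otimes> s" by (rule comm[OF yX that rH])
        also have "inv ?r \<otimes> (?r \<otimes> s) = s"
          by (simp only: germ_isotropy_carrier[OF that] r m_assoc[symmetric] inv_closed l_inv l_one)
        finally show ?thesis .
      qed
      have "((\<lambda>s. fourier_coeff b s ?y * (fourier_coeff a (inv s \<otimes> ?r) ?y * z))
        has_sum Rep_ell2 (a (b (ell2_single (h, y) z))) (g, x)) ?H"
        by (rule has_sum_reindex_bij_witness[where i = "\<lambda>s. inv s \<otimes> ?r" and j = "\<lambda>s. inv s \<otimes> ?r",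
              THEN iffD1, OF _ _ _ _ _ _ ab])
          (use invol rH in auto)
      then show ?thesis using ba by (rule has_sum_unique)
    qed
  qed
qed

section \<open>From a commutative relative commutant to abelian isotropy\<close>

text \<open>In row (g, x) the two products multiply by d at \<open>inv s\<close> g x and at g x
  respectively. These points agree wherever f(g x) is nonzero, and elsewhere both products
  vanish.\<close>

lemma generator_in_commutant:
  assumes f: "continuous_map X euclidean f" and s: "s \<in> carrier G"
    and supp: "\<And>y. y \<in> topspace X \<Longrightarrow> f y \<noteq> 0 \<Longrightarrow> \<phi> s y = y"
  shows "cp_fun G X \<phi> f o\<^sub>L cp_shift G X s \<in> cp_commutant"
proof -
  let ?u = "cp_fun G X \<phi> f o\<^sub>L cp_shift G X s"
  have "?u o\<^sub>L cp_fun G X \<phi> d = cp_fun G X \<phi> d o\<^sub>L ?u" if d: "continuous_map X euclidean d" for d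
  proof (rule blinfun_eqI, rule ell2_eqI, clarify)
    fix \<xi> g x
    have dapp: "Rep_ell2 (cp_fun G X \<phi> d \<eta>) (k, y) =
      (if k \<in> carrier G \<and> y \<in> topspace X then d (\<phi> k y) * Rep_ell2 \<eta> (k, y) else 0)" for \<eta> k y
      by (rule cp_fun_apply[OF compact group_action_axioms d])
    have "d (\<phi> (inv s \<otimes> g) x) = d (\<phi> g x)"
      if "g \<in> carrier G" "x \<in> topspace X" "f (\<phi> g x) \<noteq> 0"
    proof -
      have "\<phi> (inv s) (\<phi> g x) = \<phi> g x"
        using that s act_in by (intro orbit_sym_aux supp) auto
      then show ?thesis using that s by (simp add: composition_rule)
    qed
    then show "Rep_ell2 ((?u o\<^sub>L cp_fun G X \<phi> d) \<xi>) (g, x) = Rep_ell2 ((cp_fun G X \<phi> d o\<^sub>L ?u) \<xi>) (g, x)"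
      unfolding blinfun_apply_blinfun_compose[of ?u] blinfun_apply_blinfun_compose[of _ ?u]
      by (simp only: generator_apply[OF f s] dapp) (use s in auto)
  qed
  then show ?thesis
    using generator_in_algebra[OF f s] by (auto simp: relative_commutant_def cp_base_def)
qed

lemma germ_isotropy_commute:
  assumes comm: "\<And>a b. a \<in> cp_commutant \<Longrightarrow> b \<in> cp_commutant \<Longrightarrow> a o\<^sub>L b = b o\<^sub>L a"
    and x: "x \<in> topspace X"
    and s: "s \<in> germ_isotropy G X \<phi> x" and t: "t \<in> germ_isotropy G X \<phi> x"
  shows "s \<otimes> t = t \<otimes> s"
proof -
  \<comment> \<open>The intersection allows one bump function to serve both \<open>s\<close> and
    \<open>t\<close>.\<close>
  let ?W = "X interior_of invariants (topspace X) \<phi> s \<inter> X interior_of invariants (topspace X) \<phi> t"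
  have W: "openin X ?W" "x \<in> ?W"
    using s t by (auto simp: germ_isotropy_def intro: openin_Int openin_interior_of)
  obtain f :: "'x \<Rightarrow> complex" where f: "continuous_map X euclidean f" "f x = 1"
    and f0: "\<And>y. y \<in> topspace X \<Longrightarrow> y \<notin> ?W \<Longrightarrow> f y = 0"
    using Urysohn_point[OF compact hausdorff W] by blast
  have supp: "\<phi> s y = y" "\<phi> t y = y" if "y \<in> topspace X" "f y \<noteq> 0" for y
    using f0[OF that(1)] that(2) interior_of_subset[of X] by (fastforce simp: invariants_def)+
  note sG = germ_isotropy_carrier[OF s] and tG = germ_isotropy_carrier[OF t]
  let ?u = "\<lambda>s. cp_fun G X \<phi> f o\<^sub>L cp_shift G X s"
  \<comment> \<open>Reading row (1, x), the first factor contributes f(x) and leads to row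
    \<open>inv p\<close>, where the second contributes f at \<open>inv p\<close> x, again x. Both
    values are 1, so only the group shift remains.\<close>
  have uu: "Rep_ell2 ((?u p o\<^sub>L ?u q) \<xi>) (\<one>, x) = Rep_ell2 \<xi> (inv (p \<otimes> q), x)"
    if p: "p \<in> carrier G" "\<phi> p x = x" and q: "q \<in> carrier G" for p q \<xi>
    unfolding blinfun_apply_blinfun_compose[of "?u p"] generator_apply[OF f(1) p(1)]
      generator_apply[OF f(1) q]
    using p q x f(2) orbit_sym_aux[OF p(1) x p(2)] by (simp add: act_one inv_mult_group)
  have "?u s \<in> cp_commutant" "?u t \<in> cp_commutant"
    by (auto intro!: generator_in_commutant f sG tG supp)
  then have "?u s o\<^sub>L ?u t = ?u t o\<^sub>L ?u s" by (rule comm)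
  then have "Rep_ell2 \<xi> (inv (s \<otimes> t), x) = Rep_ell2 \<xi> (inv (t \<otimes> s), x)" for \<xi>
    using uu[OF sG germ_isotropy_fixes[OF s] tG, of \<xi>] uu[OF tG germ_isotropy_fixes[OF t] sG, of \<xi>]
    by simp
  \<comment> \<open>A basis vector is nonzero at exactly one index, so equal values here force the
    two group elements to coincide.\<close>
  from this[of "ell2_single (inv (s \<otimes> t), x) 1"] have "inv (t \<otimes> s) = inv (s \<otimes> t)"
    by (simp add: ell2_single.rep_eq split: if_splits)
  then show ?thesis using sG tG by (metis inv_inv m_closed)
qed

lemma comm_group_germ_isotropy_iff:
  assumes "x \<in> topspace X"
  shows "comm_group (G\<lparr>carrier := germ_isotropy G X \<phi> x\<rparr>) \<longleftrightarrow>
    (\<forall>s\<in>germ_isotropy G X \<phi> x. \<forall>t\<in>germ_isotropy G X \<phi> x. s \<otimes> t = t \<otimes> s)"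
proof
  assume "comm_group (G\<lparr>carrier := germ_isotropy G X \<phi> x\<rparr>)"
  then interpret H: comm_group "G\<lparr>carrier := germ_isotropy G X \<phi> x\<rparr>" .
  show "\<forall>s\<in>germ_isotropy G X \<phi> x. \<forall>t\<in>germ_isotropy G X \<phi> x. s \<otimes> t = t \<otimes> s"
    using H.m_comm by simp
next
  assume "\<forall>s\<in>germ_isotropy G X \<phi> x. \<forall>t\<in>germ_isotropy G X \<phi> x. s \<otimes> t = t \<otimes> s"
  then show "comm_group (G\<lparr>carrier := germ_isotropy G X \<phi> x\<rparr>)"
    using subgroup.subgroup_is_group[OF subgroup_germ_isotropy[OF assms] is_group]
    by (intro group.group_comm_groupI) auto
qed

end

theorem theorem6p6:
  fixes G :: "('g, 'm) monoid_scheme" and X :: "'x topology" and \<phi> :: "'g \<Rightarrow> 'x \<Rightarrow> 'x"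
  assumes "compact_space X" and "Hausdorff_space X"
    and "group_action G (topspace X) \<phi>"
    and "\<And>s. s \<in> carrier G \<Longrightarrow> homeomorphic_map X X (\<phi> s)"
  shows "(\<forall>a \<in> relative_commutant (cp_base G X \<phi>) (reduced_crossed_product G X \<phi>).
           \<forall>b \<in> relative_commutant (cp_base G X \<phi>) (reduced_crossed_product G X \<phi>).
             a o\<^sub>L b = b o\<^sub>L a)
    \<longleftrightarrow> (\<forall>x \<in> topspace X. comm_group (G\<lparr>carrier := germ_isotropy G X \<phi> x\<rparr>))"
proof -
  interpret compact_hausdorff_action G X \<phi>
    using assms by (simp add: compact_hausdorff_action_def compact_hausdorff_action_axioms_def)
  show ?thesis
    using commutant_commute germ_isotropy_commute by (simp add: comm_group_germ_isotropy_iff) blast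
qed

end
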